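(* Let $d\ge1$, $0<c_j<1$ for $j=1,\dots,d$, let $\mathbf{X}_0$ and $\mathbf{Y}_n=(Y_{n,1},\dots,Y_{n,d})$, $n\ge1$, be independent random vectors in $\mathbb{R}^d$ with $\mathbf{Y}_n\sim G$ for all $n$, and let $X_{n,j}=\max(c_jX_{n-1,j},\,Y_{n,j})$ for $n\ge1$, $j=1,\dots,d$. Suppose $\{\mathbf{X}_n=(X_{n,1},\dots,X_{n,d})\}$ is stationary with common non-degenerate distribution function $F$. Then $\{\mathbf{X}_n\}_{n\ge1}$ satisfies the strong-mixing condition: there exist numbers $\alpha_s$ with $\alpha_s\to0$ as $s\to\infty$ such that, for all $p,s\ge1$, all $A\in\mathcal{B}(\mathbf{X}_1,\dots,\mathbf{X}_p)$ and all $B\in\mathcal{B}(\mathbf{X}_{p+s+1},\mathbf{X}_{p+s+2},\dots)$, $$|P(A\cap B)-P(A)P(B)|\le\alpha_s .$$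
   Context: $\mathcal{B}(\cdot)$ denotes the $\sigma$-field generated by the indicated random vectors. A distribution function $F$ on $\mathbb{R}^d$ is non-degenerate if $0<F(\mathbf{x})<1$ for some $\mathbf{x}\in\mathbb{R}^d$. *)

theory Defs
  imports "HOL-Probability.Probability"
begin

(* Multivariate counterpart of the library's cdf. The order on real ^ 'd is
   componentwise, so {..x} is the orthant of all y with y $ j \<le> x $ j for every j. *)
definition mv_cdf :: "(real ^ 'd) measure \<Rightarrow> real ^ 'd \<Rightarrow> real" where
  "mv_cdf N x = measure N {..x}"

definition nondegenerate_cdf :: "(real ^ 'd \<Rightarrow> real) \<Rightarrow> bool" where
  "nondegenerate_cdf F \<longleftrightarrow> (\<exists>x. 0 < F x \<and> F x < 1)"

definition generated_events ::
  "'a measure \<Rightarrow> 'b measure \<Rightarrow> (nat \<Rightarrow> 'a \<Rightarrow> 'b) \<Rightarrow> nat set \<Rightarrow> 'a set set" where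
  "generated_events M N Z I =
     sigma_sets (space M) (\<Union>n\<in>I. {Z n -` S \<inter> space M | S. S \<in> sets N})"

(* Strict stationarity: the finite-dimensional distributions are shift invariant. *)
definition stationary_process ::
  "'a measure \<Rightarrow> 'b measure \<Rightarrow> (nat \<Rightarrow> 'a \<Rightarrow> 'b) \<Rightarrow> bool" where
  "stationary_process M N Z \<longleftrightarrow>
     (\<forall>J h. finite J \<longrightarrow>
        distr M (Pi\<^sub>M J (\<lambda>_. N)) (\<lambda>\<omega>. \<lambda>n\<in>J. Z (n + h) \<omega>) =
        distr M (Pi\<^sub>M J (\<lambda>_. N)) (\<lambda>\<omega>. \<lambda>n\<in>J. Z n \<omega>))"

end

theory Submission
  imports Defs
begin

text \<open>
  The recursion contracts the influence of its starting value. Fix a time \<open>p\<close> and let \<open>X'\<close> be the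
  process that is restarted at time \<open>p\<close> from \<open>0\<close> and is driven by the same innovations
  \<open>Y (p + 1), Y (p + 2), \<dots>\<close>. Two facts make \<open>X'\<close> useful.

  \<^item> At time \<open>p + m\<close>, coordinate \<open>j\<close> of \<open>X\<close> either coincides with that of \<open>X'\<close>, and then does so
    forever, or it is nonzero and of modulus at most \<open>(c $ j) ^ m * \<bar>X p $ j\<bar>\<close>
    (\<open>max_recursion_coupling\<close>). With \<open>r = sqrt (c $ j)\<close>, the second case forces
    \<open>0 < \<bar>X (p + m) $ j\<bar> \<le> r ^ m\<close> or \<open>1 \<le> r ^ m * \<bar>X p $ j\<bar>\<close>. By stationarity the probabilities
    of these events do not depend on \<open>p\<close>, and they tend to \<open>0\<close> as \<open>m\<close> grows because, written for
    one variable with the stationary law, the events shrink to the empty set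
    (\<open>prob_small_or_large_tendsto_0\<close>).

  \<^item> \<open>X'\<close> is a function of the innovations after time \<open>p\<close>, whereas \<open>X 1, \<dots>, X p\<close> are functions of
    \<open>X 0, Y 1, \<dots>, Y p\<close>. Hence events of \<open>X'\<close> are independent of events of \<open>X 1, \<dots>, X p\<close>.

  An event \<open>B\<close> of the future of \<open>X\<close> therefore agrees, outside an event \<open>E\<close> whose probability is small
  uniformly in \<open>p\<close>, with an event \<open>B'\<close> that is independent of \<open>A\<close> (\<open>generated_events_coupling\<close>), and
  replacing \<open>B\<close> by \<open>B'\<close> changes each of \<open>P(A \<inter> B)\<close> and \<open>P(A) P(B)\<close> by at most \<open>P(E)\<close>.

  The strict inequality \<open>0 < \<bar>X (p + m) $ j\<bar>\<close> is essential: in dimension two or more a coordinate may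
  vanish identically, and then \<open>\<bar>X (p + m) $ j\<bar> \<le> r ^ m\<close> always holds. This is why the restart is from \<open>0\<close>, where such a
  coordinate is matched exactly.
\<close>

section \<open>Generated \<open>\<sigma>\<close>-fields\<close>

lemma generated_events_eq_sets:
  "generated_events M N Z I =
    sets (sigma (space M) (\<Union>n\<in>I. {Z n -` S \<inter> space M | S. S \<in> sets N}))"
  unfolding generated_events_def by (subst sets_measure_of) auto

lemma measurable_generated_sigma:
  fixes Z :: "nat \<Rightarrow> 'a \<Rightarrow> 'b"
  assumes "Z n \<in> space M \<rightarrow> space N" and "n \<in> I"
  shows "Z n \<in> measurable (sigma (space M) (\<Union>n\<in>I. {Z n -` S \<inter> space M | S. S \<in> sets N})) N"
proof (rule measurableI)
  fix S assume "S \<in> sets N"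
  then have "Z n -` S \<inter> space M \<in> generated_events M N Z I"
    unfolding generated_events_def using assms(2) by (intro sigma_sets.Basic) blast
  then show "Z n -` S \<inter> space (sigma (space M) (\<Union>n\<in>I. {Z n -` S \<inter> space M | S. S \<in> sets N}))
      \<in> sets (sigma (space M) (\<Union>n\<in>I. {Z n -` S \<inter> space M | S. S \<in> sets N}))"
    by (simp add: generated_events_eq_sets space_measure_of_conv)
qed (use assms in \<open>auto simp: space_measure_of_conv\<close>)

lemma generated_events_subset_sets:
  fixes Z :: "nat \<Rightarrow> 'a \<Rightarrow> 'b"
  assumes "space S = space M" and "\<And>n. n \<in> I \<Longrightarrow> Z n \<in> measurable S N"
  shows "generated_events M N Z I \<subseteq> sets S"
  unfolding generated_events_def assms(1)[symmetric]
  by (rule sets.sigma_sets_subset) (use assms(2) in \<open>auto intro: measurable_sets\<close>)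

text \<open>Agreement outside \<open>E\<close> is preserved by complements and countable unions, so agreement of the
  generating variables carries over to the generated \<open>\<sigma>\<close>-fields.\<close>

lemma generated_events_coupling:
  fixes Z Z' :: "nat \<Rightarrow> 'a \<Rightarrow> 'b"
  assumes "\<And>n \<omega>. n \<in> I \<Longrightarrow> \<omega> \<in> space M - E \<Longrightarrow> Z n \<omega> = Z' n \<omega>"
    and "B \<in> generated_events M N Z I"
  shows "\<exists>B' \<in> generated_events M N Z' I. B - E = B' - E"
  using assms(2) unfolding generated_events_def
proof (induction rule: sigma_sets.induct)
  case (Basic B)
  then obtain n S where nS: "n \<in> I" "S \<in> sets N" "B = Z n -` S \<inter> space M"
    by blast
  have "Z' n -` S \<inter> space M \<in> sigma_sets (space M) (\<Union>n\<in>I. {Z' n -` S \<inter> space M | S. S \<in> sets N})"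
    using nS by (intro sigma_sets.Basic) blast
  moreover have "B - E = Z' n -` S \<inter> space M - E"
    using nS assms(1) by auto
  ultimately show ?case by blast
next
  case Empty
  show ?case using sigma_sets.Empty by blast
next
  case (Compl B)
  then obtain B' where B': "B' \<in> sigma_sets (space M) (\<Union>n\<in>I. {Z' n -` S \<inter> space M | S. S \<in> sets N})"
    "B - E = B' - E" by blast
  then have "(space M - B) - E = (space M - B') - E" by blast
  with sigma_sets.Compl[OF B'(1)] show ?case by (rule bexI[rotated])
next
  case (Union B)
  then have "\<forall>i. \<exists>C. C \<in> sigma_sets (space M) (\<Union>n\<in>I. {Z' n -` S \<inter> space M | S. S \<in> sets N}) \<and>
      B i - E = C - E" by blast
  from choice[OF this] obtain B' where B':
    "\<And>i. B' i \<in> sigma_sets (space M) (\<Union>n\<in>I. {Z' n -` S \<inter> space M | S. S \<in> sets N})"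
    "\<And>i. B i - E = B' i - E" by blast
  have "(\<Union>i. B i) - E = (\<Union>i. B' i) - E" using B'(2) by blast
  with sigma_sets.Union[of B', OF B'(1)] show ?case by (rule bexI[rotated])
qed

section \<open>Dependence bounds from agreement outside a small event\<close>

lemma (in prob_space) indep_generated_events:
  assumes "indep_vars (\<lambda>_. N) W UNIV" and "I \<inter> J = {}"
    and "A \<in> generated_events M N W I" and "B \<in> generated_events M N W J"
  shows "prob (A \<inter> B) = prob A * prob B"
proof -
  let ?E = "\<lambda>n. {W n -` S \<inter> space M | S. S \<in> sets N}"
  let ?I = "case_bool I J"
  have stable: "Int_stable (?E n)" for n
  proof (rule Int_stableI)
    fix a b assume "a \<in> ?E n" "b \<in> ?E n"
    then obtain S T where ST: "S \<in> sets N" "T \<in> sets N"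
      "a = W n -` S \<inter> space M" "b = W n -` T \<inter> space M" by blast
    then have "a \<inter> b = W n -` (S \<inter> T) \<inter> space M" "S \<inter> T \<in> sets N" by auto
    then show "a \<inter> b \<in> ?E n" by blast
  qed
  have "indep_sets ?E UNIV"
    using assms(1) by (simp add: indep_vars_def2)
  then have "indep_sets ?E (\<Union>b\<in>UNIV. ?I b)"
    by (rule indep_sets_mono_index[rotated]) auto
  moreover have "disjoint_family_on ?I UNIV"
    using assms(2) by (auto simp: disjoint_family_on_def split: bool.splits)
  ultimately have "indep_sets (\<lambda>b. sigma_sets (space M) (\<Union>n\<in>?I b. ?E n)) UNIV"
    by (intro indep_sets_collect_sigma stable)
  moreover have "(\<lambda>b. sigma_sets (space M) (\<Union>n\<in>?I b. ?E n)) =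
      case_bool (generated_events M N W I) (generated_events M N W J)"
    by (auto simp: generated_events_def split: bool.splits)
  ultimately have "indep_set (generated_events M N W I) (generated_events M N W J)"
    by (simp add: indep_set_def)
  then show ?thesis using assms(3,4) by (rule indep_setD)
qed

lemma (in prob_space) prob_diff_le_if_agree_outside:
  assumes "B \<in> events" "B' \<in> events" "E \<in> events" and "B - E = B' - E"
  shows "\<bar>prob B - prob B'\<bar> \<le> prob E"
proof -
  have "prob C \<le> prob D + prob E"
    if "C \<in> events" "D \<in> events" "C - E = D - E" for C D
  proof -
    have "prob C \<le> prob (D \<union> E)"
      using that assms(3) by (intro finite_measure_mono) auto
    also have "\<dots> \<le> prob D + prob E"
      using that assms(3) by (intro measure_Un_le) auto
    finally show ?thesis .
  qed
  from this[of B B'] this[of B' B] assms show ?thesis by auto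
qed

lemma (in prob_space) mixing_bound_if_agree_outside:
  assumes "A \<in> events" "B \<in> events" "B' \<in> events" "E \<in> events"
    and "B - E = B' - E" and "prob (A \<inter> B') = prob A * prob B'"
  shows "\<bar>prob (A \<inter> B) - prob A * prob B\<bar> \<le> 2 * prob E"
proof -
  have "\<bar>prob (A \<inter> B) - prob (A \<inter> B')\<bar> \<le> prob E"
    using assms by (intro prob_diff_le_if_agree_outside) auto
  moreover have "\<bar>prob A * prob B' - prob A * prob B\<bar> \<le> prob E"
  proof -
    have "\<bar>prob A * prob B' - prob A * prob B\<bar> = prob A * \<bar>prob B - prob B'\<bar>"
      by (metis abs_minus_commute abs_mult abs_of_nonneg measure_nonneg right_diff_distrib)
    also have "\<dots> \<le> 1 * prob E"
      using assms by (intro mult_mono prob_diff_le_if_agree_outside) auto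
    finally show ?thesis by simp
  qed
  ultimately show ?thesis using assms(6) by linarith
qed

section \<open>The max-autoregressive recursion restarted from zero\<close>

definition max_step :: "real ^ 'd \<Rightarrow> real ^ 'd \<Rightarrow> real ^ 'd \<Rightarrow> real ^ 'd" where
  "max_step c x y = (\<chi> j. max (c $ j * x $ j) (y $ j))"

primrec zero_restart :: "real ^ 'd \<Rightarrow> (nat \<Rightarrow> real ^ 'd) \<Rightarrow> nat \<Rightarrow> nat \<Rightarrow> real ^ 'd" where
  "zero_restart c y p 0 = 0"
| "zero_restart c y p (Suc m) = max_step c (zero_restart c y p m) (y (p + Suc m))"

lemma measurable_max_step:
  assumes "f \<in> borel_measurable M" "g \<in> borel_measurable M"
  shows "(\<lambda>\<omega>. max_step c (f \<omega>) (g \<omega>)) \<in> borel_measurable M"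
  using assms
  by (rule borel_measurable_continuous_Pair)
    (unfold max_step_def, intro continuous_intros)

lemma measurable_zero_restart:
  assumes "\<And>n. n > p \<Longrightarrow> Y n \<in> borel_measurable M"
  shows "(\<lambda>\<omega>. zero_restart c (\<lambda>n. Y n \<omega>) p m) \<in> borel_measurable M"
proof (induction m)
  case (Suc m)
  then show ?case
    using assms[of "p + Suc m"] by (simp add: measurable_max_step)
qed simp

text \<open>Both recursions take the maximum with the same \<open>y\<close>, so they merge at the first time when \<open>y\<close>
  wins in both. If \<open>x p\<close> is positive, the value carried over in \<open>x\<close> has won at every step before
  that and is the geometrically decayed \<open>x p\<close>. If \<open>x p\<close> is negative, then \<open>x\<close> is caught between
  that decayed value and \<open>0\<close> until some \<open>y\<close> is nonnegative, and such a \<open>y\<close> wins in both.\<close>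

lemma max_recursion_coupling:
  fixes c :: "real ^ 'd"
  assumes c: "0 < c $ j" "c $ j < 1"
    and x: "\<And>n. x (Suc n) = max_step c (x n) (y (Suc n))"
  shows "x (p + m) $ j = zero_restart c y p m $ j \<or>
    (0 < \<bar>x (p + m) $ j\<bar> \<and> \<bar>x (p + m) $ j\<bar> \<le> (c $ j) ^ m * \<bar>x p $ j\<bar>)"
proof -
  define a where "a m = (c $ j) ^ m * x p $ j" for m
  define b where "b m = x (p + m) $ j" for m
  define z where "z m = zero_restart c y p m $ j" for m
  have a_Suc: "a (Suc m) = c $ j * a m" for m by (simp add: a_def)
  have b_Suc: "b (Suc m) = max (c $ j * b m) (y (p + Suc m) $ j)" for m
    by (simp add: b_def x max_step_def)
  have z_Suc: "z (Suc m) = max (c $ j * z m) (y (p + Suc m) $ j)" for m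
    by (simp add: z_def max_step_def)
  \<comment> \<open>Not inductive without a record of the order: \<open>z m \<le> b m\<close> makes every \<open>y\<close> that beats \<open>b\<close> beat
    \<open>z\<close> as well, and \<open>z m = 0\<close> makes every \<open>y \<ge> 0\<close> win in both.\<close>
  have "b m = z m \<or> (0 < b m \<and> b m \<le> a m \<and> z m \<le> b m) \<or> (b m < 0 \<and> a m \<le> b m \<and> z m = 0)" for m
  proof (induction m)
    case 0
    then show ?case by (auto simp: a_def b_def z_def)
  next
    case (Suc m)
    let ?y = "y (p + Suc m) $ j"
    consider "b m = z m" | "0 < b m" "b m \<le> a m" "z m \<le> b m" | "b m < 0" "a m \<le> b m" "z m = 0"
      using Suc by blast
    then show ?case
    proof cases
      case 1
      then show ?thesis by (simp add: b_Suc z_Suc)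
    next
      case 2
      then have "0 < c $ j * b m" "c $ j * b m \<le> c $ j * a m" "c $ j * z m \<le> c $ j * b m"
        using c by auto
      then show ?thesis by (auto simp: a_Suc b_Suc z_Suc max_def)
    next
      case 3
      then have "c $ j * b m < 0" "c $ j * a m \<le> c $ j * b m"
        using c by (auto simp: mult_pos_neg)
      then show ?thesis using 3 by (auto simp: a_Suc b_Suc z_Suc max_def)
    qed
  qed
  moreover have "\<bar>a m\<bar> = (c $ j) ^ m * \<bar>x p $ j\<bar>"
    using c by (simp add: a_def abs_mult)
  ultimately show ?thesis
    by (fastforce simp: b_def z_def)
qed

section \<open>Probability of late coupling\<close>

text \<open>A drop by the factor \<open>c ^ m\<close> is a statement about two times. Splitting the factor evenly as
  \<open>sqrt c ^ m * sqrt c ^ m\<close> replaces it by two alternatives that concern one time each, so that only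
  the marginal law enters.\<close>

lemma small_or_large_of_geometric_drop:
  fixes u v c :: real
  assumes "0 < c" and "\<bar>v\<bar> \<le> c ^ m * \<bar>u\<bar>"
  shows "\<bar>v\<bar> \<le> sqrt c ^ m \<or> 1 \<le> sqrt c ^ m * \<bar>u\<bar>"
proof (rule disjCI)
  assume "\<not> 1 \<le> sqrt c ^ m * \<bar>u\<bar>"
  then have "sqrt c ^ m * (sqrt c ^ m * \<bar>u\<bar>) \<le> sqrt c ^ m * 1"
    using assms(1) by (intro mult_left_mono) auto
  moreover have "c ^ m = sqrt c ^ m * sqrt c ^ m"
    using assms(1) by (simp flip: power_mult_distrib)
  ultimately show "\<bar>v\<bar> \<le> sqrt c ^ m"
    using assms(2) by (simp add: mult.assoc)
qed

lemma (in prob_space) prob_small_or_large_tendsto_0: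
  fixes U :: "'a \<Rightarrow> real" and r :: real
  assumes U: "U \<in> borel_measurable M" and r: "0 < r" "r < 1"
  shows "(\<lambda>m. prob {\<omega>\<in>space M. (0 < \<bar>U \<omega>\<bar> \<and> \<bar>U \<omega>\<bar> \<le> r ^ m) \<or> 1 \<le> r ^ m * \<bar>U \<omega>\<bar>}) \<longlonglongrightarrow> 0"
    (is "(\<lambda>m. prob (?S m)) \<longlonglongrightarrow> 0")
proof -
  have "range ?S \<subseteq> events" using U by auto
  moreover have "decseq ?S"
  proof (rule decseq_SucI)
    fix m
    have "r ^ Suc m \<le> r ^ m" using r by (simp add: mult_le_cancel_right1)
    then have "r ^ Suc m * \<bar>u\<bar> \<le> r ^ m * \<bar>u\<bar>" for u by (rule mult_right_mono) simp
    with \<open>r ^ Suc m \<le> r ^ m\<close> show "?S (Suc m) \<subseteq> ?S m"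
      by (auto simp del: power_Suc intro: order_trans)
  qed
  ultimately have "(\<lambda>m. prob (?S m)) \<longlonglongrightarrow> prob (\<Inter>m. ?S m)"
    by (rule finite_Lim_measure_decseq)
  moreover have "(\<Inter>m. ?S m) = {}"
  proof (rule equals0I)
    fix \<omega> assume \<omega>: "\<omega> \<in> (\<Inter>m. ?S m)"
    have pow: "(\<lambda>m. r ^ m) \<longlonglongrightarrow> 0" using r by (intro LIMSEQ_power_zero) auto
    have "\<forall>\<^sub>F m in sequentially. r ^ m * \<bar>U \<omega>\<bar> < 1"
      using tendsto_mult_left_zero[OF pow] by (rule order_tendstoD(2)) simp
    moreover have "\<forall>\<^sub>F m in sequentially. U \<omega> \<noteq> 0 \<longrightarrow> r ^ m < \<bar>U \<omega>\<bar>"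
      using order_tendstoD(2)[OF pow, of "\<bar>U \<omega>\<bar>"] by (cases "U \<omega> = 0") auto
    ultimately have "\<forall>\<^sub>F m in sequentially. \<omega> \<notin> ?S m"
      by eventually_elim auto
    then show False using \<omega> by (auto dest: eventually_happens)
  qed
  ultimately show ?thesis by simp
qed

lemma (in prob_space) stationary_prob_eq:
  assumes "stationary_process M N Z" and Z: "\<And>n. Z n \<in> measurable M N" and "S \<in> sets N"
  shows "prob (Z n -` S \<inter> space M) = prob (Z 0 -` S \<inter> space M)"
proof -
  let ?P = "Pi\<^sub>M {0::nat} (\<lambda>_. N)"
  let ?S = "(\<lambda>f. f 0) -` S \<inter> space ?P"
  have S: "?S \<in> sets ?P" using assms(3) by (intro measurable_sets) auto
  have meas: "(\<lambda>\<omega>. \<lambda>i\<in>{0}. Z (i + h) \<omega>) \<in> measurable M ?P" for h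
    using Z by (intro measurable_restrict) auto
  have "prob (Z h -` S \<inter> space M) = measure (distr M ?P (\<lambda>\<omega>. \<lambda>i\<in>{0}. Z (i + h) \<omega>)) ?S" for h
    unfolding measure_distr[OF meas S]
    by (rule arg_cong[where f = prob])
      (use measurable_space[OF Z] in \<open>auto simp: space_PiM\<close>)
  from this[of n] this[of 0] assms(1) show ?thesis
    by (simp add: stationary_process_def)
qed

section \<open>Strong mixing\<close>

theorem proposition3p1:
  fixes M :: "'a measure"
    and c :: "real ^ 'd"
    and X Y :: "nat \<Rightarrow> 'a \<Rightarrow> real ^ 'd"
    and F G :: "real ^ 'd \<Rightarrow> real"
  assumes "prob_space M"
    and "\<And>j. 0 < c $ j \<and> c $ j < 1"
    and "prob_space.indep_vars M (\<lambda>_. borel) (\<lambda>n. if n = 0 then X 0 else Y n) UNIV"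
    and "\<And>n. n \<ge> 1 \<Longrightarrow> mv_cdf (distr M borel (Y n)) = G"
    and "\<And>n j \<omega>. n \<ge> 1 \<Longrightarrow> \<omega> \<in> space M \<Longrightarrow>
           X n \<omega> $ j = max (c $ j * X (n - 1) \<omega> $ j) (Y n \<omega> $ j)"
    and "stationary_process M borel X"
    and "\<And>n. mv_cdf (distr M borel (X n)) = F"
    and "nondegenerate_cdf F"
  shows "\<exists>\<alpha> :: nat \<Rightarrow> real. \<alpha> \<longlonglongrightarrow> 0 \<and>
           (\<forall>p s A B. p \<ge> 1 \<longrightarrow> s \<ge> 1 \<longrightarrow>
              A \<in> generated_events M borel X {1..p} \<longrightarrow>
              B \<in> generated_events M borel X {p + s + 1..} \<longrightarrow>
              \<bar>measure M (A \<inter> B) - measure M A * measure M B\<bar> \<le> \<alpha> s)"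
proof -
  interpret prob_space M by fact
  define W where "W n = (if n = 0 then X 0 else Y n)" for n
  define gen where
    "gen I = sigma (space M) (\<Union>n\<in>I. {W n -` S \<inter> space M | S. S \<in> sets borel})" for I
  have sets_gen: "sets (gen I) = generated_events M borel W I" for I
    by (simp add: gen_def generated_events_eq_sets)
  have space_gen: "space (gen I) = space M" for I
    by (simp add: gen_def space_measure_of_conv)
  have W_indep: "indep_vars (\<lambda>_. borel) W UNIV"
    using assms(3) by (simp add: W_def[abs_def])
  then have W_meas: "W n \<in> borel_measurable M" for n
    by (auto simp: indep_vars_def2)
  have W_gen: "W n \<in> borel_measurable (gen I)" if "n \<in> I" for n I
    unfolding gen_def by (rule measurable_generated_sigma) (use that in auto)
  have gen_events: "sets (gen I) \<subseteq> events" for I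
    unfolding sets_gen by (rule generated_events_subset_sets) (auto intro: W_meas)

  have c: "0 < c $ j" "c $ j < 1" for j using assms(2) by auto
  have rec: "X (Suc n) \<omega> = max_step c (X n \<omega>) (W (Suc n) \<omega>)" if "\<omega> \<in> space M" for n \<omega>
    using assms(5)[of "Suc n" \<omega>] that by (simp add: vec_eq_iff max_step_def W_def)
  have X_gen: "n \<le> k \<Longrightarrow> X n \<in> borel_measurable (gen {..k})" for n k
  proof (induction n)
    case 0
    then show ?case using W_gen[of 0 "{..k}"] by (simp add: W_def)
  next
    case (Suc n)
    then have "(\<lambda>\<omega>. max_step c (X n \<omega>) (W (Suc n) \<omega>)) \<in> borel_measurable (gen {..k})"
      by (intro measurable_max_step W_gen) auto
    then show ?case
      by (subst measurable_cong[of _ _ "\<lambda>\<omega>. max_step c (X n \<omega>) (W (Suc n) \<omega>)"])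
        (auto simp: rec space_gen)
  qed
  have X_meas: "X n \<in> borel_measurable M" for n
    using measurable_sets[OF X_gen[of n n]] gen_events[of "{..n}"]
    by (intro measurableI) (auto simp: space_gen)

  define T where "T j m = {v :: real ^ 'd. (0 < \<bar>v $ j\<bar> \<and> \<bar>v $ j\<bar> \<le> sqrt (c $ j) ^ m) \<or>
    1 \<le> sqrt (c $ j) ^ m * \<bar>v $ j\<bar>}" for j m
  define E where "E p m = (\<Union>j. (X (p + m) -` T j m \<inter> space M) \<union> (X p -` T j m \<inter> space M))" for p m
  \<comment> \<open>One factor \<open>2\<close> is for the two times in \<open>E\<close>, the other for the two replacements of \<open>B\<close>.\<close>
  define \<alpha> where "\<alpha> s = 4 * (\<Sum>j\<in>UNIV. prob (X 0 -` T j (Suc s) \<inter> space M))" for s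
  have nth_meas: "(\<lambda>v :: real ^ 'd. v $ j) \<in> borel_measurable borel" for j
    by (intro borel_measurable_continuous_onI continuous_intros)
  have T_sets: "T j m \<in> sets borel" for j m
  proof -
    have "{v \<in> space borel. (0 < \<bar>v $ j\<bar> \<and> \<bar>v $ j\<bar> \<le> sqrt (c $ j) ^ m) \<or>
        1 \<le> sqrt (c $ j) ^ m * \<bar>v $ j\<bar>} \<in> sets (borel :: (real ^ 'd) measure)"
      using nth_meas by measurable
    then show ?thesis by (simp add: T_def)
  qed
  have X_T_events: "X n -` T j m \<inter> space M \<in> events" for n j m
    using X_meas T_sets by (rule measurable_sets)
  then have E_events: "E p m \<in> events" for p m
    unfolding E_def by (intro sets.finite_UN) auto

  have prob_E: "prob (E p (Suc s)) \<le> \<alpha> s / 2" for p s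
  proof -
    have "prob (E p (Suc s)) \<le>
        (\<Sum>j\<in>UNIV. prob ((X (p + Suc s) -` T j (Suc s) \<inter> space M) \<union> (X p -` T j (Suc s) \<inter> space M)))"
      unfolding E_def using X_T_events by (intro finite_measure_subadditive_finite) auto
    also have "\<dots> \<le> (\<Sum>j\<in>UNIV. prob (X (p + Suc s) -` T j (Suc s) \<inter> space M) +
        prob (X p -` T j (Suc s) \<inter> space M))"
      using X_T_events by (intro sum_mono measure_Un_le) auto
    also have "\<dots> = \<alpha> s / 2"
      unfolding stationary_prob_eq[OF assms(6) X_meas T_sets, of "p + Suc s"]
        stationary_prob_eq[OF assms(6) X_meas T_sets, of p]
      by (simp add: \<alpha>_def flip: sum_distrib_left)
    finally show ?thesis .
  qed

  have "\<alpha> \<longlonglongrightarrow> 0"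
  proof -
    have "(\<lambda>m. prob (X 0 -` T j m \<inter> space M)) \<longlonglongrightarrow> 0" for j
    proof -
      have "(\<lambda>\<omega>. X 0 \<omega> $ j) \<in> borel_measurable M"
        using X_meas nth_meas by (rule measurable_compose)
      from prob_small_or_large_tendsto_0[OF this, of "sqrt (c $ j)"] c[of j]
      have "(\<lambda>m. prob {\<omega>\<in>space M. X 0 \<omega> \<in> T j m}) \<longlonglongrightarrow> 0"
        by (simp add: T_def)
      then show ?thesis by (simp add: vimage_def Int_def conj_commute)
    qed
    then have "(\<lambda>s. prob (X 0 -` T j (Suc s) \<inter> space M)) \<longlonglongrightarrow> 0" for j
      by (rule LIMSEQ_Suc)
    then have "\<alpha> \<longlonglongrightarrow> 4 * (\<Sum>j\<in>(UNIV :: 'd set). 0)"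
      unfolding \<alpha>_def by (intro tendsto_intros)
    then show ?thesis by simp
  qed

  moreover have "\<bar>prob (A \<inter> B) - prob A * prob B\<bar> \<le> \<alpha> s"
    if A: "A \<in> generated_events M borel X {1..p}"
      and B: "B \<in> generated_events M borel X {p + s + 1..}" for p s A B
  proof -
    define X' where "X' n \<omega> = zero_restart c (\<lambda>n. W n \<omega>) p (n - p)" for n \<omega>
    \<comment> \<open>Agreement at the first time of the future persists, since both processes follow the same
      recursion, so one exceptional event serves all generators of the future.\<close>
    have agree: "X n \<omega> = X' n \<omega>" if n: "n \<in> {p + s + 1..}" and \<omega>: "\<omega> \<in> space M - E p (Suc s)" for n \<omega>
    proof -
      have "X (p + Suc s) \<omega> $ j = zero_restart c (\<lambda>n. W n \<omega>) p (Suc s) $ j" for j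
      proof -
        have "\<not> (0 < \<bar>X (p + Suc s) \<omega> $ j\<bar> \<and> \<bar>X (p + Suc s) \<omega> $ j\<bar> \<le> (c $ j) ^ Suc s * \<bar>X p \<omega> $ j\<bar>)"
        proof
          assume *: "0 < \<bar>X (p + Suc s) \<omega> $ j\<bar> \<and> \<bar>X (p + Suc s) \<omega> $ j\<bar> \<le> (c $ j) ^ Suc s * \<bar>X p \<omega> $ j\<bar>"
          with small_or_large_of_geometric_drop[of "c $ j" "X (p + Suc s) \<omega> $ j" "Suc s" "X p \<omega> $ j"] c
          have "X (p + Suc s) \<omega> \<in> T j (Suc s) \<or> X p \<omega> \<in> T j (Suc s)"
            unfolding T_def mem_Collect_eq by blast
          then show False using \<omega> by (auto simp: E_def)
        qed
        moreover have "X (Suc n) \<omega> = max_step c (X n \<omega>) (W (Suc n) \<omega>)" for n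
          using rec \<omega> by simp
        ultimately show ?thesis
          using max_recursion_coupling[of c j "\<lambda>n. X n \<omega>" "\<lambda>n. W n \<omega>" p "Suc s"] c by blast
      qed
      then have start: "X (p + Suc s) \<omega> = zero_restart c (\<lambda>n. W n \<omega>) p (Suc s)"
        by (simp add: vec_eq_iff)
      have "X (p + (Suc s + k)) \<omega> = zero_restart c (\<lambda>n. W n \<omega>) p (Suc s + k)" for k
      proof (induction k)
        case 0
        then show ?case using start by simp
      next
        case (Suc k)
        then show ?case using rec[of \<omega> "p + (Suc s + k)"] \<omega> by simp
      qed
      moreover obtain k where "n = p + (Suc s + k)"
        using n by (auto simp: le_iff_add)
      ultimately show ?thesis unfolding X'_def by (metis add_diff_cancel_left')
    qed
    from generated_events_coupling[where Z' = X', OF agree B]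
    obtain B' where B': "B' \<in> generated_events M borel X' {p + s + 1..}"
      "B - E p (Suc s) = B' - E p (Suc s)" by blast
    have "X' n \<in> borel_measurable (gen {p<..})" for n
      unfolding X'_def by (intro measurable_zero_restart W_gen) auto
    then have "generated_events M borel X' {p + s + 1..} \<subseteq> sets (gen {p<..})"
      by (intro generated_events_subset_sets) (auto simp: space_gen)
    with B'(1) have B'_gen: "B' \<in> sets (gen {p<..})" by blast
    have "X n \<in> borel_measurable (gen {..p})" if "n \<in> {1..p}" for n
      using X_gen that by simp
    then have "generated_events M borel X {1..p} \<subseteq> sets (gen {..p})"
      by (intro generated_events_subset_sets) (auto simp: space_gen)
    with A have A_gen: "A \<in> sets (gen {..p})" by blast
    have "{..p} \<inter> {p<..} = {}" by auto
    with A_gen B'_gen have "prob (A \<inter> B') = prob A * prob B'"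
      unfolding sets_gen by (intro indep_generated_events[OF W_indep])
    moreover have "B \<in> events"
      using B generated_events_subset_sets[of M M "{p + s + 1..}" X borel] X_meas by blast
    ultimately have "\<bar>prob (A \<inter> B) - prob A * prob B\<bar> \<le> 2 * prob (E p (Suc s))"
      using A_gen B'_gen gen_events E_events B'(2)
      by (intro mixing_bound_if_agree_outside[where B' = B']) auto
    with prob_E[of p s] show ?thesis by linarith
  qed
  ultimately show ?thesis by blast
qed

end
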